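(* Suppose that for each $l=1,\dots,M+Q$ the induced subgraph $\mathcal{G}^{[l]}$ is undirected and connected, and that for each $i\in\mathcal{V}$: $f_i$ is convex and has $\alpha$-Lipschitz gradient for some $\alpha>0$, and the matrix whose rows are $A_i^{[m]}$, $m\in\mathcal{I}_i$, and $E_i^{[q]}$, $q\in\mathcal{E}_i$, has full row rank. Let $C>0$ be such that some minimizer of $\min_y\phi(y)$ lies in $\mathcal{Y}=[-C,C]^{\sum_{l=1}^{M+Q}|\mathcal{V}^{[l]}|}$, and let $G>0$ be such that $\|\nabla\phi(y)\|\le G$ for all $y\in\mathcal{Y}$. Let the violation-free distributed gradient iteration described in the context be run with $$\gamma_t=\frac{\sqrt{2\Theta}}{G\sqrt{t+1}},\qquad \Theta=\max_{x,y\in\mathcal{Y}}\frac{\|x-y\|^2}{2}.$$ Then for all $t\ge2$, the solution $\big(x_i(y_i^{(t)})\big)_{i=1}^N$ of the reformulated problem with auxiliary variable fixed to $y=y^{(t)}$ is a feasible solution of $(\mathrm{P})$, and $$\min_{\tau=0,1,\dots,t}\ \sum_{i=1}^N\Big(f_i\big(x_i(y_i^{(\tau)})\big)-f_i(x_i^* )\Big)\le\frac{2(1+\log 3)\,G\sqrt{2\Theta}}{\sqrt{t+2}},$$ where $(x_i^* )_{i=1}^N$ is an optimal solution of $(\mathrm{P})$.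
   Context: Agents are indexed by $\mathcal{V}=\{1,\dots,N\}$. For each agent $i$: $x_i\in\mathbb{R}^{d_i}$, $f_i:\mathbb{R}^{d_i}\to\mathbb{R}$, $A_i\in\mathbb{R}^{M\times d_i}$, $b_i\in\mathbb{R}^M$, $E_i\in\mathbb{R}^{Q\times d_i}$, $g_i\in\mathbb{R}^Q$. $A_i^{[m]}$ is the $m$-th row of $A_i$, $b_i^{[m]}$ the $m$-th entry of $b_i$; $E_i^{[q]}$, $g_i^{[q]}$ similarly. The original problem is $$(\mathrm{P})\quad \min_{x_1,\dots,x_N}\ \sum_{i=1}^N f_i(x_i)\quad\text{s.t.}\quad \sum_{i=1}^N (A_i x_i+b_i)\le 0,\qquad \sum_{i=1}^N (E_i x_i+g_i)=0.$$ Affected agents: $\mathcal{V}^{[m]}=\{j: A_j^{[m]}\ne 0 \text{ or } b_j^{[m]}\neq 0\}$ for $m=1,\dots,M$, and $\mathcal{V}^{[M+q]}=\{j: E_j^{[q]}\ne0\text{ or }g_j^{[q]}\ne0\}$ for $q=1,\dots,Q$. $\mathcal{I}_i=\{m: i\in\mathcal{V}^{[m]}\}$ and $\mathcal{E}_i=\{q: i\in\mathcal{V}^{[M+q]}\}$. Communication: $\mathcal{G}=(\mathcal{V},\mathcal{S})$ is an undirected graph; $\mathcal{G}^{[l]}$ is the subgraph of $\mathcal{G}$ induced by $\mathcal{V}^{[l]}$, $l=1,\dots,M+Q$; $\mathcal{N}_i^{[l]}$ is the set of neighbors of $i$ in $\mathcal{G}^{[l]}$, including $i$ itself. For each $l$,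 $P^{[l]}=[p_{ij}^{[l]}]$ is a symmetric nonnegative matrix with rows and columns indexed by $\mathcal{V}^{[l]}$, with $p_{ij}^{[l]}>0$ if $j\in\mathcal{N}_i^{[l]}$, $p_{ij}^{[l]}=0$ otherwise, and $\sum_j p_{ij}^{[l]}=1$ for all $i$. Auxiliary variables: $y^{[l]}=\mathrm{col}(\{y_i^{[l]}\}_{i\in\mathcal{V}^{[l]}})\in\mathbb{R}^{|\mathcal{V}^{[l]}|}$ ($\mathrm{col}$ denotes stacking), $y=\mathrm{col}(y^{[1]},\dots,y^{[M+Q]})$, and $y_i$ is the collection of those $y_j^{[l]}$ with $j\in\mathcal{N}_i^{[l]}$, $l\in\mathcal{I}_i\cup\{M+q:q\in\mathcal{E}_i\}$. Local problem: for given $y_i$, $$(\mathrm{P}_i)\quad \phi_i(y_i)=\min_{x_i} f_i(x_i)\ \text{ s.t. }\ A_i^{[m]}x_i+y_i^{[m]}-\sum_{j}p_{ij}^{[m]}y_j^{[m]}+b_i^{[m]}\le0,\ m\in\mathcal{I}_i,$$ $$E_i^{[q]}x_i+y_i^{[M+q]}-\sum_j p_{ij}^{[M+q]}y_j^{[M+q]}+g_i^{[q]}=0,\ q\in\mathcal{E}_i,$$ with an optimal solution denoted $x_i(y_i)$ (an optimal solution is taken to exist for every $y_i$). Put $\phi(y)=\sum_{i=1}^N\phi_i(y_i)$, which is convex and differentiable in this setting. The reformulated problem is to minimize $\sum_i f_i(x_i)$ jointly over $(x,y)$ subject to all constraints of $(\mathrm{P}_1),\dots,(\mathrm{P}_N)$;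 for fixed $y$, $(x_i(y_i))_{i=1}^N$ solves it, so it is equivalent to $\min_y\phi(y)$. Iteration: start from an arbitrary $y^{(0)}$. For $t=1,2,\dots$, each agent $i$ updates, for every $l\in\mathcal{I}_i\cup\{M+q:q\in\mathcal{E}_i\}$, $$y_i^{[l],(t)}=\mathrm{Proj}_{[-C,C]}\Big(y_i^{[l],(t-1)}-\gamma_t\nabla_{y_i^{[l]}}\phi(y^{(t-1)})\Big),$$ where $\mathrm{Proj}_{[-C,C]}$ is projection onto the interval $[-C,C]$. $y^{(t)}$ denotes the variable after iteration $t$, and $y_i^{(t)}$ the collection of components of $y^{(t)}$ relevant to agent $i$, as for $y_i$. $\log$ is the natural logarithm. *)

theory Defs
  imports
    "HOL-Analysis.Derivative"
    "HOL-Analysis.Starlike"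
    "HOL-Analysis.L2_Norm"
    "Jordan_Normal_Form.DL_Rank"
begin

text \<open>
  The dimensions of the agents' variables may differ from agent to agent, so vectors and matrices
  are those of \<^theory>\<open>Jordan_Normal_Form.Matrix\<close>. These are not a type class instance of
  real vector spaces; norm, gradient and convexity are therefore spelled out on
  \<^term>\<open>carrier_vec n\<close>. All indices start at 0.
\<close>

definition vec_norm :: "real vec \<Rightarrow> real" where
  "vec_norm v = L2_set (vec_index v) {..<dim_vec v}"

definition convex_fun_on_vec :: "nat \<Rightarrow> (real vec \<Rightarrow> real) \<Rightarrow> bool" where
  "convex_fun_on_vec n f \<longleftrightarrow>
     (\<forall>x \<in> carrier_vec n. \<forall>y \<in> carrier_vec n. \<forall>u v :: real. 0 \<le> u \<longrightarrow> 0 \<le> v \<longrightarrow> u + v = 1 \<longrightarrow>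
        f (u \<cdot>\<^sub>v x + v \<cdot>\<^sub>v y) \<le> u * f x + v * f y)"

definition has_gradient_vec :: "nat \<Rightarrow> (real vec \<Rightarrow> real) \<Rightarrow> real vec \<Rightarrow> real vec \<Rightarrow> bool" where
  "has_gradient_vec n f D x \<longleftrightarrow> D \<in> carrier_vec n \<and>
     (\<forall>e > 0. \<exists>d > 0. \<forall>h \<in> carrier_vec n. vec_norm h < d \<longrightarrow>
        \<bar>f (x + h) - f x - scalar_prod D h\<bar> \<le> e * vec_norm h)"

definition lipschitz_gradient_vec :: "nat \<Rightarrow> (real vec \<Rightarrow> real) \<Rightarrow> real \<Rightarrow> bool" where
  "lipschitz_gradient_vec n f \<alpha> \<longleftrightarrow>
     (\<exists>F. (\<forall>x \<in> carrier_vec n. has_gradient_vec n f (F x) x) \<and>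
        (\<forall>x \<in> carrier_vec n. \<forall>y \<in> carrier_vec n. vec_norm (F x - F y) \<le> \<alpha> * vec_norm (x - y)))"

definition full_row_rank :: "real mat \<Rightarrow> bool" where
  "full_row_rank B \<longleftrightarrow> vec_space.rank (dim_row B) B = dim_row B"

text \<open>
  Agents are \<open>i < agents\<close>; the \<open>ineqs\<close> inequality constraints come before the \<open>eqs\<close> equality
  constraints in the joint numbering \<open>l < ineqs + eqs\<close>. The graph on the agents is the relation
  \<open>edges\<close>, and \<open>weight l\<close> is the mixing matrix of constraint \<open>l\<close>.
\<close>

record network =
  agents :: nat
  ineqs :: nat
  eqs :: nat
  dimn :: "nat \<Rightarrow> nat"
  cost :: "nat \<Rightarrow> real vec \<Rightarrow> real"
  A_mat :: "nat \<Rightarrow> real mat"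
  b_vec :: "nat \<Rightarrow> real vec"
  E_mat :: "nat \<Rightarrow> real mat"
  g_vec :: "nat \<Rightarrow> real vec"
  edges :: "(nat \<times> nat) set"
  weight :: "nat \<Rightarrow> nat \<Rightarrow> nat \<Rightarrow> real"

definition well_dimensioned :: "network \<Rightarrow> bool" where
  "well_dimensioned P \<longleftrightarrow> (\<forall>i < agents P.
     A_mat P i \<in> carrier_mat (ineqs P) (dimn P i) \<and> b_vec P i \<in> carrier_vec (ineqs P) \<and>
     E_mat P i \<in> carrier_mat (eqs P) (dimn P i) \<and> g_vec P i \<in> carrier_vec (eqs P))"

definition feasible :: "network \<Rightarrow> (nat \<Rightarrow> real vec) \<Rightarrow> bool" where
  "feasible P x \<longleftrightarrow>
     (\<forall>i < agents P. x i \<in> carrier_vec (dimn P i)) \<and>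
     (\<forall>m < ineqs P. (\<Sum>i < agents P. (A_mat P i *\<^sub>v x i + b_vec P i) $ m) \<le> 0) \<and>
     (\<forall>q < eqs P. (\<Sum>i < agents P. (E_mat P i *\<^sub>v x i + g_vec P i) $ q) = 0)"

definition total_cost :: "network \<Rightarrow> (nat \<Rightarrow> real vec) \<Rightarrow> real" where
  "total_cost P x = (\<Sum>i < agents P. cost P i (x i))"

definition affected :: "network \<Rightarrow> nat \<Rightarrow> nat set" where
  "affected P l = {j. j < agents P \<and>
     (if l < ineqs P
      then row (A_mat P j) l \<noteq> 0\<^sub>v (dimn P j) \<or> b_vec P j $ l \<noteq> 0
      else row (E_mat P j) (l - ineqs P) \<noteq> 0\<^sub>v (dimn P j) \<or> g_vec P j $ (l - ineqs P) \<noteq> 0)}"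

definition ineqs_of :: "network \<Rightarrow> nat \<Rightarrow> nat set" where
  "ineqs_of P i = {m. m < ineqs P \<and> i \<in> affected P m}"

definition eqs_of :: "network \<Rightarrow> nat \<Rightarrow> nat set" where
  "eqs_of P i = {q. q < eqs P \<and> i \<in> affected P (ineqs P + q)}"

definition constraint_rows :: "network \<Rightarrow> nat \<Rightarrow> real mat" where
  "constraint_rows P i = mat_of_rows (dimn P i)
     (map (row (A_mat P i)) (sorted_list_of_set (ineqs_of P i)) @
      map (row (E_mat P i)) (sorted_list_of_set (eqs_of P i)))"

definition undirected_graph :: "network \<Rightarrow> bool" where
  "undirected_graph P \<longleftrightarrow> edges P \<subseteq> {..<agents P} \<times> {..<agents P} \<and> sym (edges P)"

definition induced_edges :: "network \<Rightarrow> nat \<Rightarrow> (nat \<times> nat) set" where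
  "induced_edges P l = edges P \<inter> affected P l \<times> affected P l"

text \<open>A constraint that affects no agent induces the empty graph, which counts as connected.\<close>

definition induced_connected :: "network \<Rightarrow> nat \<Rightarrow> bool" where
  "induced_connected P l \<longleftrightarrow>
     (\<forall>i \<in> affected P l. \<forall>j \<in> affected P l. (i, j) \<in> (induced_edges P l)\<^sup>*)"

definition nbrs :: "network \<Rightarrow> nat \<Rightarrow> nat \<Rightarrow> nat set" where
  "nbrs P l i = insert i {j. (i, j) \<in> induced_edges P l}"

definition mixing_weights :: "network \<Rightarrow> nat \<Rightarrow> bool" where
  "mixing_weights P l \<longleftrightarrow>
     (\<forall>i \<in> affected P l. \<forall>j \<in> affected P l.
        0 \<le> weight P l i j \<and> weight P l i j = weight P l j i \<and>
        (if j \<in> nbrs P l i then 0 < weight P l i j else weight P l i j = 0)) \<and>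
     (\<forall>i \<in> affected P l. (\<Sum>j \<in> affected P l. weight P l i j) = 1)"

text \<open>
  The stacked auxiliary vector \<open>y\<close> is a family indexed by the pairs \<open>(l, i)\<close> with \<open>i\<close> affected by
  constraint \<open>l\<close>, and extended by \<^term>\<open>undefined\<close> outside this index set; likewise for its part
  that is relevant to one agent.
\<close>

type_synonym aux = "nat \<times> nat \<Rightarrow> real"

definition aux_idx :: "network \<Rightarrow> (nat \<times> nat) set" where
  "aux_idx P = {(l, i). l < ineqs P + eqs P \<and> i \<in> affected P l}"

definition aux_space :: "network \<Rightarrow> aux set" where
  "aux_space P = extensional (aux_idx P)"

definition aux_box :: "network \<Rightarrow> real \<Rightarrow> aux set" where
  "aux_box P C = aux_idx P \<rightarrow>\<^sub>E {- C .. C}"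

definition local_idx :: "network \<Rightarrow> nat \<Rightarrow> (nat \<times> nat) set" where
  "local_idx P i = {(l, j). l \<in> ineqs_of P i \<union> (\<lambda>q. ineqs P + q) ` eqs_of P i \<and> j \<in> nbrs P l i}"

definition local_aux :: "network \<Rightarrow> nat \<Rightarrow> aux \<Rightarrow> aux" where
  "local_aux P i y = restrict y (local_idx P i)"

definition local_feasible :: "network \<Rightarrow> nat \<Rightarrow> aux \<Rightarrow> real vec set" where
  "local_feasible P i yi = {x \<in> carrier_vec (dimn P i).
     (\<forall>m \<in> ineqs_of P i.
        scalar_prod (row (A_mat P i) m) x
          + yi (m, i) - (\<Sum>j \<in> nbrs P m i. weight P m i j * yi (m, j)) + b_vec P i $ m \<le> 0) \<and>
     (\<forall>q \<in> eqs_of P i. let l = ineqs P + q in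
        scalar_prod (row (E_mat P i) q) x
          + yi (l, i) - (\<Sum>j \<in> nbrs P l i. weight P l i j * yi (l, j)) + g_vec P i $ q = 0)}"

definition local_solution :: "network \<Rightarrow> nat \<Rightarrow> aux \<Rightarrow> real vec \<Rightarrow> bool" where
  "local_solution P i yi x \<longleftrightarrow> is_arg_min (cost P i) (\<lambda>x. x \<in> local_feasible P i yi) x"

definition local_value :: "network \<Rightarrow> nat \<Rightarrow> aux \<Rightarrow> real" where
  "local_value P i yi = (INF x \<in> local_feasible P i yi. cost P i x)"

definition phi :: "network \<Rightarrow> aux \<Rightarrow> real" where
  "phi P y = (\<Sum>i < agents P. local_value P i (local_aux P i y))"

definition reformulated_feasible :: "network \<Rightarrow> (nat \<Rightarrow> real vec) \<Rightarrow> aux \<Rightarrow> bool" where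
  "reformulated_feasible P x y \<longleftrightarrow>
     (\<forall>i < agents P. x i \<in> local_feasible P i (local_aux P i y))"

definition grad_phi :: "network \<Rightarrow> aux \<Rightarrow> aux" where
  "grad_phi P y = (\<lambda>k \<in> aux_idx P. deriv (\<lambda>s. phi P (y(k := s))) (y k))"

definition aux_norm :: "network \<Rightarrow> aux \<Rightarrow> real" where
  "aux_norm P z = L2_set z (aux_idx P)"

text \<open>The supremum is a maximum, because the box is compact and nonempty for \<open>C \<ge> 0\<close>.\<close>

definition Theta :: "network \<Rightarrow> real \<Rightarrow> real" where
  "Theta P C =
     (SUP (x, y) \<in> aux_box P C \<times> aux_box P C. (aux_norm P (\<lambda>k. x k - y k))\<^sup>2 / 2)"

primrec iterate :: "network \<Rightarrow> real \<Rightarrow> (nat \<Rightarrow> real) \<Rightarrow> aux \<Rightarrow> nat \<Rightarrow> aux" where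
  "iterate P C \<gamma> y0 0 = y0"
| "iterate P C \<gamma> y0 (Suc t) =
     (\<lambda>k \<in> aux_idx P. closest_point {- C .. C}
        (iterate P C \<gamma> y0 t k - \<gamma> (Suc t) * grad_phi P (iterate P C \<gamma> y0 t) k))"

end

theory Submission
  imports Defs
begin

text \<open>
  Symmetric stochastic weights make the disagreement terms \<open>y\<^sub>i - (\<Sum>j. p\<^sub>i\<^sub>j y\<^sub>j)\<close> of every constraint
  sum to 0, so local feasibility implies feasibility. Conversely, on a connected graph every family
  of sum 0 is a family of disagreement terms, so some \<open>y\<close> makes a given feasible point locally
  feasible; hence the minimum of \<open>\<phi>\<close> is at most the optimal value.

  The function \<open>\<phi>\<close> is convex, and because of the full row rank it lies below a differentiable function
  that touches it at a given point. So it has partial derivatives, and they satisfy the gradient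
  inequality. The usual projected gradient estimate, summed over the second half of the
  iterations only, then gives a rate without a logarithmic factor.
\<close>

section \<open>Full row rank and graph Laplacians\<close>

text \<open>A maximal independent set of columns has as many elements as the rank, here
  \<open>dim_row B\<close>. It is therefore a basis of the target space, and the columns span
  everything.\<close>

lemma full_row_rank_surj:
  assumes "full_row_rank B" and w: "w \<in> carrier_vec (dim_row B)"
  obtains v where "v \<in> carrier_vec (dim_col B)" "B *\<^sub>v v = w"
proof -
  interpret vec_space "TYPE(real)" "dim_row B" .
  have B: "B \<in> carrier_mat (dim_row B) (dim_col B)" by simp
  have cols: "set (cols B) \<subseteq> carrier_vec (dim_row B)" using cols_dim by blast
  obtain S where S: "maximal S (\<lambda>T. T \<subseteq> set (cols B) \<and> lin_indpt T)"
    using maximal_exists[of "\<lambda>T. T \<subseteq> set (cols B) \<and> lin_indpt T" "card (set (cols B))" "{}"]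
    by (meson List.finite_set card_mono empty_iff empty_subsetI finite_lin_indpt2 rev_finite_subset)
  then have sub: "S \<subseteq> set (cols B)" and li: "lin_indpt S"
    by (auto simp: maximal_def)
  have "card S = dim_row B"
    using rank_card_indpt[OF B S] assms(1) by (simp add: full_row_rank_def)
  moreover have "finite S" using sub finite_subset by blast
  ultimately have "basis S"
    using subset_trans[OF sub cols] li by (intro dim_li_is_basis) (simp_all add: dim_is_n)
  then have "carrier_vec (dim_row B) \<subseteq> span (set (cols B))"
    using span_is_monotone[OF sub] by (auto simp: basis_def)
  with w have "w \<in> col_space B" by (auto simp: col_space_def)
  then show ?thesis
    using that by (auto simp: col_space_eq[OF B])
qed

text \<open>By surjectivity the rows of an agent's constraint matrix can take arbitrary prescribed
  values on a common \<open>v\<close>. This later supplies the direction in which an agent moves to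
  absorb a change of \<open>y\<close>.\<close>

lemma constraint_direction:
  assumes "well_dimensioned P" "i < agents P" "full_row_rank (constraint_rows P i)"
  obtains v where "v \<in> carrier_vec (dimn P i)"
    "\<And>m. m \<in> ineqs_of P i \<Longrightarrow> scalar_prod (row (A_mat P i) m) v = c m"
    "\<And>q. q \<in> eqs_of P i \<Longrightarrow> scalar_prod (row (E_mat P i) q) v = d q"
proof -
  define I where "I = sorted_list_of_set (ineqs_of P i)"
  define J where "J = sorted_list_of_set (eqs_of P i)"
  define rs where "rs = map (row (A_mat P i)) I @ map (row (E_mat P i)) J"
  have I: "set I = ineqs_of P i" and J: "set J = eqs_of P i"
    by (simp_all add: I_def J_def ineqs_of_def eqs_of_def)
  have B: "constraint_rows P i = mat_of_rows (dimn P i) rs"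
    by (simp add: constraint_rows_def rs_def I_def J_def)
  define w where "w = vec_of_list (map c I @ map d J)"
  have "w \<in> carrier_vec (dim_row (constraint_rows P i))"
    by (rule carrier_vecI) (simp only: w_def B rs_def dim_vec_of_list mat_of_rows_carrier length_append length_map)
  then obtain v where v: "v \<in> carrier_vec (dimn P i)" and Bv: "constraint_rows P i *\<^sub>v v = w"
    using full_row_rank_surj[OF assms(3)] by (auto simp: B)
  have rs: "set rs \<subseteq> carrier_vec (dimn P i)"
    using assms(1,2) by (auto simp: rs_def well_dimensioned_def intro!: carrier_vecI)
  have eq: "scalar_prod (rs ! r) v = (map c I @ map d J) ! r" if "r < length rs" for r
  proof -
    have "scalar_prod (rs ! r) v = vec_index (constraint_rows P i *\<^sub>v v) r"
      using that rs by (simp add: B mat_of_rows_row nth_mem subset_code(1))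
    also have "\<dots> = (map c I @ map d J) ! r"
      by (simp add: Bv w_def vec_of_list_index)
    finally show ?thesis .
  qed
  have "scalar_prod (row (A_mat P i) m) v = c m" if "m \<in> ineqs_of P i" for m
  proof -
    from that obtain r where "r < length I" "I ! r = m" using I by (metis in_set_conv_nth)
    then show ?thesis using eq[of r] by (simp add: rs_def nth_append)
  qed
  moreover have "scalar_prod (row (E_mat P i) q) v = d q" if "q \<in> eqs_of P i" for q
  proof -
    from that obtain r where "r < length J" "J ! r = q" using J by (metis in_set_conv_nth)
    \<comment> \<open>The equality rows follow the inequality rows in \<open>rs\<close>, hence the
      offset.\<close>
    then show ?thesis using eq[of "length I + r"] by (simp add: rs_def nth_append)
  qed
  ultimately show ?thesis using that v by blast
qed

text \<open>Maximum principle: where the maximum is attained, it is a weighted mean of values that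
  are at most the maximum, so every neighbour of positive weight attains it too. Connectedness
  spreads this over all of \<open>S\<close>.\<close>

lemma harmonic_constant:
  fixes w :: "'a \<Rightarrow> 'a \<Rightarrow> real" and y :: "'a \<Rightarrow> real"
  assumes fin: "finite S"
    and nonneg: "\<And>i j. i \<in> S \<Longrightarrow> j \<in> S \<Longrightarrow> 0 \<le> w i j"
    and total: "\<And>i. i \<in> S \<Longrightarrow> (\<Sum>j\<in>S. w i j) = 1"
    and edges: "\<And>i j. (i, j) \<in> E \<Longrightarrow> i \<in> S \<and> j \<in> S \<and> 0 < w i j"
    and conn: "\<And>i j. i \<in> S \<Longrightarrow> j \<in> S \<Longrightarrow> (i, j) \<in> E\<^sup>*"
    and harmonic: "\<And>i. i \<in> S \<Longrightarrow> y i = (\<Sum>j\<in>S. w i j * y j)"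
    and ij: "i \<in> S" "j \<in> S"
  shows "y i = y j"
proof -
  define m where "m = Max (y ` S)"
  have le: "y k \<le> m" if "k \<in> S" for k using fin that by (simp add: m_def)
  have "m \<in> y ` S" unfolding m_def using fin ij by (intro Max_in) auto
  then obtain k where k: "k \<in> S" "y k = m" by auto
  have "y l = m \<and> l \<in> S" if "(k, l) \<in> E\<^sup>*" for l
    using that
  proof (induction rule: rtrancl_induct)
    case base
    show ?case using k by simp
  next
    case (step a b)
    have a: "a \<in> S" "y a = m" and b: "b \<in> S" "0 < w a b" using step edges by auto
    have "(\<Sum>j\<in>S. w a j * (m - y j)) = m * (\<Sum>j\<in>S. w a j) - (\<Sum>j\<in>S. w a j * y j)"
      by (simp add: right_diff_distrib sum_subtractf sum_distrib_left mult.commute)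
    also have "\<dots> = 0" using total[OF a(1)] harmonic[OF a(1)] a by simp
    finally have "\<forall>j\<in>S. w a j * (m - y j) = 0"
      using fin nonneg a le by (subst (asm) sum_nonneg_eq_0_iff) auto
    with b show ?case by force
  qed
  with conn[OF k(1)] ij show ?thesis by metis
qed

text \<open>The kernel of the Laplacian consists of the constants, and by symmetry its image is the
  set of families of sum 0. The linear algebra is done with an \<open>N\<close> by \<open>N\<close>
  matrix that acts as the identity on the indices outside \<open>S\<close>.\<close>

lemma laplacian_solvable:
  fixes w :: "nat \<Rightarrow> nat \<Rightarrow> real" and r :: "nat \<Rightarrow> real"
  assumes S: "S \<subseteq> {..<N}"
    and nonneg: "\<And>i j. i \<in> S \<Longrightarrow> j \<in> S \<Longrightarrow> 0 \<le> w i j"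
    and sym: "\<And>i j. i \<in> S \<Longrightarrow> j \<in> S \<Longrightarrow> w i j = w j i"
    and total: "\<And>i. i \<in> S \<Longrightarrow> (\<Sum>j\<in>S. w i j) = 1"
    and edges: "\<And>i j. (i, j) \<in> E \<Longrightarrow> i \<in> S \<and> j \<in> S \<and> 0 < w i j"
    and conn: "\<And>i j. i \<in> S \<Longrightarrow> j \<in> S \<Longrightarrow> (i, j) \<in> E\<^sup>*"
    and r: "sum r S = 0"
  obtains y where "\<And>i. i \<in> S \<Longrightarrow> y i - (\<Sum>j\<in>S. w i j * y j) = r i"
proof (cases "S = {}")
  case True
  then show ?thesis using that by blast
next
  case False
  have fin: "finite S" using S finite_subset by blast
  define n where "n = real (card S)"
  have n: "n > 0" using False fin by (simp add: n_def card_gt_0_iff)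
  txt \<open>Adding the projection onto constants makes the Laplacian invertible.\<close>
  define M where "M = mat N N (\<lambda>(i, j). (if i = j then 1 else 0) +
    (if i \<in> S \<and> j \<in> S then 1 / n - w i j else 0))"
  have M: "M \<in> carrier_mat N N" by (simp add: M_def)
  have Mv: "vec_index (M *\<^sub>v v) i = vec_index v i +
      (if i \<in> S then (\<Sum>j\<in>S. vec_index v j) / n - (\<Sum>j\<in>S. w i j * vec_index v j) else 0)"
    if v: "v \<in> carrier_vec N" and i: "i < N" for v i
  proof -
    have "vec_index (M *\<^sub>v v) i = (\<Sum>j<N. ((if i = j then 1 else 0) +
        (if i \<in> S \<and> j \<in> S then 1 / n - w i j else 0)) * vec_index v j)"
      using v i by (simp add: M_def scalar_prod_def atLeast0LessThan)
    also have "\<dots> = (\<Sum>j<N. (if j = i then vec_index v j else 0) +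
        (if j \<in> S then (if i \<in> S then (1 / n - w i j) * vec_index v j else 0) else 0))"
      by (rule sum.cong) (auto simp: distrib_right)
    also have "\<dots> = vec_index v i + (\<Sum>j\<in>{..<N} \<inter> S. if i \<in> S then (1 / n - w i j) * vec_index v j else 0)"
      using i unfolding sum.distrib by (subst sum.inter_restrict) simp_all
    also have "{..<N} \<inter> S = S" using S by blast
    also have "vec_index v i + (\<Sum>j\<in>S. if i \<in> S then (1 / n - w i j) * vec_index v j else 0)
        = vec_index v i +
      (if i \<in> S then (\<Sum>j\<in>S. vec_index v j) / n - (\<Sum>j\<in>S. w i j * vec_index v j) else 0)"
      by (simp add: left_diff_distrib sum_subtractf sum_divide_distrib)
    finally show ?thesis .
  qed
  have cols: "(\<Sum>i\<in>S. \<Sum>j\<in>S. w i j * f j) = sum f S" for f :: "nat \<Rightarrow> real"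
  proof -
    have "(\<Sum>i\<in>S. \<Sum>j\<in>S. w i j * f j) = (\<Sum>j\<in>S. (\<Sum>i\<in>S. w j i) * f j)"
      by (subst sum.swap) (auto simp: sum_distrib_right sym intro!: sum.cong)
    then show ?thesis by (simp add: total)
  qed
  \<comment> \<open>Summing the equations over \<open>S\<close>, the Laplacian part cancels and the
    mean term leaves the sum of \<open>v\<close>. A right-hand side of sum 0 thus forces
    \<open>v\<close> to have sum 0 on \<open>S\<close>, and the added mean term disappears. This is
    used with right-hand side 0 for the kernel and with \<open>r\<close> for the solution.\<close>
  have lap: "vec_index v i - (\<Sum>j\<in>S. w i j * vec_index v j) = u i"
    if v: "v \<in> carrier_vec N" and u: "\<And>i. i \<in> S \<Longrightarrow> vec_index (M *\<^sub>v v) i = u i"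
      and "sum u S = 0" and i: "i \<in> S" for v u i
  proof -
    have eq: "vec_index v i + ((\<Sum>j\<in>S. vec_index v j) / n - (\<Sum>j\<in>S. w i j * vec_index v j)) = u i"
      if "i \<in> S" for i
      using Mv[OF v, of i] u[OF that] that S by auto
    have "0 = (\<Sum>i\<in>S. vec_index v i +
        ((\<Sum>j\<in>S. vec_index v j) / n - (\<Sum>j\<in>S. w i j * vec_index v j)))"
      using \<open>sum u S = 0\<close> eq by simp
    also have "\<dots> = (\<Sum>j\<in>S. vec_index v j)"
      using n by (simp add: sum.distrib sum_subtractf cols flip: n_def)
    finally show ?thesis using eq[OF i] by simp
  qed
  \<comment> \<open>A kernel vector is harmonic on \<open>S\<close>, hence constant there; the mean
    term then makes the constant 0. Outside \<open>S\<close> it vanishes because \<open>M\<close> is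
    the identity there.\<close>
  have "det M \<noteq> 0"
  proof
    assume "det M = 0"
    then obtain v where v: "v \<in> carrier_vec N" "v \<noteq> 0\<^sub>v N" and Mv0: "M *\<^sub>v v = 0\<^sub>v N"
      using det_0_iff_vec_prod_zero_field[OF M] by auto
    have harm: "vec_index v i = (\<Sum>j\<in>S. w i j * vec_index v j)" if "i \<in> S" for i
      using lap[OF v(1), of "\<lambda>_. 0" i] that S by (force simp: Mv0)
    have const: "vec_index v i = vec_index v j" if "i \<in> S" "j \<in> S" for i j
      using harmonic_constant[OF fin nonneg total edges conn harm that] .
    have "vec_index v i = 0" if i: "i < N" for i
    proof (cases "i \<in> S")
      case True
      have "0 = (\<Sum>j\<in>S. vec_index v j) / n"
        using Mv[OF v(1) i] harm[OF True] True i by (simp add: Mv0)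
      also have "(\<Sum>j\<in>S. vec_index v j) = (\<Sum>j\<in>S. vec_index v i)"
        by (intro sum.cong refl const True)
      finally show ?thesis using n by (simp add: n_def)
    next
      case False
      then show ?thesis using Mv[OF v(1) i] i by (simp add: Mv0)
    qed
    then have "v = 0\<^sub>v N" using v(1) by (intro eq_vecI) auto
    with v(2) show False by simp
  qed
  then have "full_row_rank M"
    using vec_space.low_rank_det_zero[OF M] M by (simp add: full_row_rank_def)
  then obtain v where v: "v \<in> carrier_vec N" "M *\<^sub>v v = vec N r"
    using full_row_rank_surj[of M "vec N r"] M by auto
  have "vec_index v i - (\<Sum>j\<in>S. w i j * vec_index v j) = r i" if "i \<in> S" for i
    using lap[OF v(1) _ r that] v(2) S by force
  then show ?thesis using that by blast
qed

section \<open>Convex functions with differentiable majorants\<close>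

text \<open>The quantifiers range over all families, not only those in \<open>aux_space P\<close>;
  this is harmless for \<open>phi\<close>, which reads only the coordinates in
  \<open>aux_idx P\<close>.\<close>

definition convex_on_funs :: "(('k \<Rightarrow> real) \<Rightarrow> real) \<Rightarrow> bool" where
  "convex_on_funs F \<longleftrightarrow> (\<forall>y z u v. 0 \<le> u \<longrightarrow> 0 \<le> v \<longrightarrow> u + v = 1 \<longrightarrow>
     F (\<lambda>k. u * y k + v * z k) \<le> u * F y + v * F z)"

text \<open>\<open>D\<close> is the slope at 0 of a differentiable majorant that touches
  \<open>F\<close> on the line through \<open>y\<close> in direction \<open>h\<close>. Unlike a
  directional derivative, it can be certified by exhibiting feasible points.\<close>

definition upper_slope :: "(('k \<Rightarrow> real) \<Rightarrow> real) \<Rightarrow> ('k \<Rightarrow> real) \<Rightarrow> ('k \<Rightarrow> real) \<Rightarrow> real \<Rightarrow> bool" where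
  "upper_slope F y h D \<longleftrightarrow> (\<exists>q. (q has_real_derivative D) (at 0) \<and> q 0 = F y \<and>
     (\<forall>s. F (\<lambda>k. y k + s * h k) \<le> q s))"

lemma convex_on_funsD:
  "convex_on_funs F \<Longrightarrow> 0 \<le> u \<Longrightarrow> 0 \<le> v \<Longrightarrow> u + v = 1 \<Longrightarrow>
    F (\<lambda>k. u * y k + v * z k) \<le> u * F y + v * F z"
  by (simp add: convex_on_funs_def)

text \<open>For \<open>s < 0\<close> the point \<open>y\<close> lies between \<open>y + s h\<close>
  and \<open>y + h\<close>, so convexity bounds the chord slope of \<open>F\<close> from
  \<open>s\<close> to 0 by the increment of \<open>F\<close> from \<open>y\<close> to
  \<open>y + h\<close>. Since \<open>s\<close> is negative, replacing \<open>F\<close> by its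
  majorant only lowers the chord slope. Letting \<open>s\<close> tend to 0 from the left gives
  \<open>D\<close>.\<close>

lemma upper_slope_le:
  assumes F: "convex_on_funs F" and "upper_slope F y h D"
  shows "F y + D \<le> F (\<lambda>k. y k + h k)"
proof -
  obtain q where q: "(q has_real_derivative D) (at 0)" "q 0 = F y"
    and maj: "\<And>s. F (\<lambda>k. y k + s * h k) \<le> q s"
    using assms(2) by (auto simp: upper_slope_def)
  have "(\<lambda>s. (q s - q 0) / s) \<midarrow>0\<rightarrow> D"
    using q(1) by (simp add: has_field_derivative_iff)
  then have lim: "((\<lambda>s. (q s - q 0) / s) \<longlongrightarrow> D) (at_left 0)"
    by (simp add: filterlim_at_split)
  have "(q s - q 0) / s \<le> F (\<lambda>k. y k + h k) - F y" if s: "s < 0" for s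
  proof -
    define r where "r = - s"
    have r: "r > 0" using s by (simp add: r_def)
    \<comment> \<open>The weights are those that express \<open>y\<close> as a convex combination of
      \<open>y + h\<close> and \<open>y - r h\<close>.\<close>
    have "F (\<lambda>k. r / (1 + r) * (y k + h k) + 1 / (1 + r) * (y k + s * h k)) \<le>
        r / (1 + r) * F (\<lambda>k. y k + h k) + 1 / (1 + r) * F (\<lambda>k. y k + s * h k)"
      by (rule convex_on_funsD[OF F]) (use r in \<open>auto simp: field_simps\<close>)
    also have "(\<lambda>k. r / (1 + r) * (y k + h k) + 1 / (1 + r) * (y k + s * h k)) = y"
    proof
      fix k
      have "r / (1 + r) * (y k + h k) + 1 / (1 + r) * (y k - r * h k) = (y k * (1 + r)) / (1 + r)"
        unfolding times_divide_eq_left add_divide_distrib[symmetric] by (simp add: algebra_simps)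
      then show "r / (1 + r) * (y k + h k) + 1 / (1 + r) * (y k + s * h k) = y k"
        using r by (simp add: r_def)
    qed
    finally have "F y \<le> (r * F (\<lambda>k. y k + h k) + F (\<lambda>k. y k + s * h k)) / (1 + r)"
      by (simp add: add_divide_distrib)
    then have "F y * (1 + r) \<le> r * F (\<lambda>k. y k + h k) + q s"
      using r maj[of s] by (simp add: field_simps)
    then show ?thesis
      using s q(2) by (simp add: field_simps r_def)
  qed
  then have "\<forall>\<^sub>F s in at_left 0. (q s - q 0) / s \<le> F (\<lambda>k. y k + h k) - F y"
    by (auto simp: eventually_at_filter)
  from tendsto_upperbound[OF lim this] show ?thesis by simp
qed

text \<open>The majorant \<open>q\<close> bounds \<open>F\<close> from above along the coordinate.
  Midpoint convexity reflects it into the lower bound \<open>2 * F y - q (- s)\<close>, which has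
  the same value and slope at 0, so the difference quotient is squeezed.\<close>

lemma upper_slope_partial_deriv:
  assumes F: "convex_on_funs F" and "upper_slope F y (\<lambda>k. if k = j then 1 else 0) D"
  shows "((\<lambda>s. F (y(j := s))) has_real_derivative D) (at (y j))"
proof -
  obtain q where q: "(q has_real_derivative D) (at 0)" "q 0 = F y"
    and "\<And>s. F (\<lambda>k. y k + s * (if k = j then 1 else 0)) \<le> q s"
    using assms(2) by (auto simp: upper_slope_def)
  moreover have "(\<lambda>k. y k + s * (if k = j then 1 else 0)) = y(j := y j + s)" for s
    by auto
  ultimately have maj: "F (y(j := y j + s)) \<le> q s" for s by simp
  define p where "p s = F (y(j := y j + s))" for s
  have mid: "2 * F y \<le> p s + p (- s)" for s
  proof -
    define a b where "a = y(j := y j + s)" and "b = y(j := y j - s)"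
    have "(\<lambda>k. 1/2 * a k + 1/2 * b k) = y"
      by (auto simp: a_def b_def fun_eq_iff field_simps)
    then have "F y \<le> 1/2 * F a + 1/2 * F b"
      using convex_on_funsD[OF F, of "1/2" "1/2" a b] by simp
    then show ?thesis by (simp add: p_def a_def b_def)
  qed
  have bound: "\<bar>(p s - F y) / s - D\<bar> \<le> \<bar>(q s - q 0) / s - D\<bar> + \<bar>(q (- s) - q 0) / (- s) - D\<bar>"
    if "s \<noteq> 0" for s
  proof -
    have 1: "\<bar>p s - F y - D * s\<bar> \<le> \<bar>q s - q 0 - D * s\<bar> + \<bar>q (- s) - q 0 + D * s\<bar>"
      using mid[of s] maj[of s] maj[of "- s"] q(2) by (simp add: p_def)
    have div: "\<bar>(a - D * t) / t\<bar> = \<bar>a - D * t\<bar> / \<bar>t\<bar>" for a t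
      by simp
    have eq: "a / t - D = (a - D * t) / t" if "t \<noteq> 0" for a t
      using that by (simp add: field_simps)
    have "\<bar>p s - F y - D * s\<bar> / \<bar>s\<bar> \<le>
        \<bar>q s - q 0 - D * s\<bar> / \<bar>s\<bar> + \<bar>q (- s) - q 0 + D * s\<bar> / \<bar>s\<bar>"
      using divide_right_mono[OF 1, of "\<bar>s\<bar>"] by (simp add: add_divide_distrib)
    then show ?thesis
      using that by (subst (1 2 3) eq) (auto simp: div)
  qed
  have lim: "(\<lambda>s. (q s - q 0) / s) \<midarrow>0\<rightarrow> D"
    using q(1) by (simp add: has_field_derivative_iff)
  moreover have "(\<lambda>s. (q (- s) - q 0) / (- s)) \<midarrow>0\<rightarrow> D"
  proof -
    have "((\<lambda>s. q (- s)) has_real_derivative D * (- 1)) (at 0)"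
      by (rule DERIV_chain2[where f = q]) (use q in \<open>auto intro!: derivative_eq_intros\<close>)
    then have "(\<lambda>s. (q (- s) - q 0) / s) \<midarrow>0\<rightarrow> - D"
      by (simp add: has_field_derivative_iff)
    from tendsto_minus[OF this] show ?thesis by simp
  qed
  ultimately have "(\<lambda>s. \<bar>(q s - q 0) / s - D\<bar> + \<bar>(q (- s) - q 0) / (- s) - D\<bar>) \<midarrow>0\<rightarrow> \<bar>D - D\<bar> + \<bar>D - D\<bar>"
    by (intro tendsto_intros)
  then have "(\<lambda>s. \<bar>(q s - q 0) / s - D\<bar> + \<bar>(q (- s) - q 0) / (- s) - D\<bar>) \<midarrow>0\<rightarrow> 0"
    by simp
  then have "(\<lambda>s. (p s - F y) / s - D) \<midarrow>0\<rightarrow> 0"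
    by (rule Lim_null_comparison[rotated]) (use bound in \<open>auto simp: eventually_at_filter\<close>)
  then have "(\<lambda>s. (p s - F y) / s) \<midarrow>0\<rightarrow> D"
    by (simp add: LIM_zero_iff)
  then show ?thesis
    by (simp add: DERIV_def p_def)
qed

text \<open>Convexity combines majorants along single coordinates into a majorant along any
  direction of finite support, one coordinate at a time.\<close>

lemma upper_slope_sum:
  assumes F: "convex_on_funs F" and "finite I"
    and "\<And>j. j \<in> I \<Longrightarrow> upper_slope F y (\<lambda>k. if k = j then 1 else 0) (g j)"
  shows "upper_slope F y (\<lambda>k. if k \<in> I then h k else 0) (\<Sum>k\<in>I. g k * h k)"
  using assms(2,3)
proof (induction I)
  case empty
  show ?case unfolding upper_slope_def by (intro exI[of _ "\<lambda>_. F y"]) auto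
next
  case (insert j I)
  let ?h = "\<lambda>k. if k \<in> I then h k else 0"
  obtain q where q: "(q has_real_derivative g j) (at 0)" "q 0 = F y"
    and majq: "\<And>s. F (\<lambda>k. y k + s * (if k = j then 1 else 0)) \<le> q s"
    using insert.prems[of j] by (auto simp: upper_slope_def)
  obtain r where r: "(r has_real_derivative (\<Sum>k\<in>I. g k * h k)) (at 0)" "r 0 = F y"
    and majr: "\<And>s. F (\<lambda>k. y k + s * ?h k) \<le> r s"
    using insert.IH insert.prems by (auto simp: upper_slope_def)
  \<comment> \<open>The moved point is the midpoint of a point moved twice as far along
    \<open>j\<close> and one moved twice as far along the other coordinates. The factors 2 in the
    arguments cancel the weights 1/2 in the derivative.\<close>
  define Q where "Q s = 1/2 * q (2 * h j * s) + 1/2 * r (2 * s)" for s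
  have "((\<lambda>s. q (2 * h j * s)) has_real_derivative g j * (2 * h j)) (at 0)"
    by (rule DERIV_chain2[where f = q]) (use q in \<open>auto intro!: derivative_eq_intros\<close>)
  moreover have "((\<lambda>s. r (2 * s)) has_real_derivative (\<Sum>k\<in>I. g k * h k) * 2) (at 0)"
    by (rule DERIV_chain2[where f = r]) (use r in \<open>auto intro!: derivative_eq_intros\<close>)
  ultimately have "(Q has_real_derivative
      1/2 * (g j * (2 * h j)) + 1/2 * ((\<Sum>k\<in>I. g k * h k) * 2)) (at 0)"
    unfolding Q_def by (intro DERIV_add DERIV_cmult)
  then have dQ: "(Q has_real_derivative (\<Sum>k\<in>insert j I. g k * h k)) (at 0)"
    using insert.hyps by simp
  have majQ: "F (\<lambda>k. y k + s * (if k \<in> insert j I then h k else 0)) \<le> Q s" for s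
  proof -
    have eq: "(\<lambda>k. y k + s * (if k \<in> insert j I then h k else 0)) =
        (\<lambda>k. 1/2 * (y k + (2 * h j * s) * (if k = j then 1 else 0)) + 1/2 * (y k + (2 * s) * ?h k))"
      using insert.hyps by (auto simp: fun_eq_iff field_simps)
    show ?thesis
      unfolding eq Q_def
      by (rule order_trans[OF convex_on_funsD[OF F] add_mono[OF mult_left_mono[OF majq[of "2 * h j * s"]]
          mult_left_mono[OF majr[of "2 * s"]]]]) simp_all
  qed
  have Q0: "Q 0 = F y" using q(2) r(2) by (simp add: Q_def)
  show ?case
    unfolding upper_slope_def using dQ Q0 majQ by blast
qed

text \<open>The window of iterations from \<open>t div 2\<close> to \<open>t\<close> contains at least half of them, while the
  squared steps taken in it sum up to at most \<open>(R / G)\<^sup>2\<close>.\<close>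

lemma projected_gradient_rate:
  fixes d e :: "nat \<Rightarrow> real"
  assumes descent: "\<And>s. 1 \<le> s \<Longrightarrow> d (Suc s) \<le>
      d s - 2 * (R / (G * sqrt (real s + 2))) * e s + (R / (G * sqrt (real s + 2)))\<^sup>2 * G\<^sup>2"
    and nonneg: "0 \<le> d (Suc t)" and diam: "\<And>s. 1 \<le> s \<Longrightarrow> d s \<le> R\<^sup>2"
    and pos: "0 < R" "0 < G" and t: "2 \<le> t"
    and \<delta>: "0 \<le> \<delta>" "\<And>s. s \<le> t \<Longrightarrow> \<delta> \<le> e s"
  shows "\<delta> \<le> 2 * G * R / sqrt (real t + 2)"
proof -
  define m where "m = t div 2"
  \<comment> \<open>The window \<open>m..t\<close> has at least \<open>(t + 2) / 2\<close> and at
    most \<open>m + 2\<close> elements. From \<open>t >= 2\<close> follows \<open>m >= 1\<close>,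
    which matters because the bounds on \<open>d\<close> start at index 1.\<close>
  have m: "1 \<le> m" "m \<le> t" "real t + 2 \<le> 2 * (real t + 1 - real m)" "real t + 1 - real m \<le> real m + 2"
    using t by (auto simp: m_def)
  \<comment> \<open>In the window the gain is estimated with the smallest step size, that of index
    \<open>t\<close>, and the squared step with the largest, that of index \<open>m\<close>.\<close>
  have step: "d (Suc s) \<le> d s - 2 * R * \<delta> / (G * sqrt (real t + 2)) + R\<^sup>2 / (real m + 2)"
    if s: "m \<le> s" "s \<le> t" for s
  proof -
    have "R / (G * sqrt (real t + 2)) * \<delta> \<le> R / (G * sqrt (real s + 2)) * e s"
      using s pos \<delta> by (intro mult_mono divide_left_mono) auto
    moreover have "(R / (G * sqrt (real s + 2)))\<^sup>2 * G\<^sup>2 = R\<^sup>2 / (real s + 2)"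
      using pos by (simp add: power_divide power_mult_distrib)
    moreover have "R\<^sup>2 / (real s + 2) \<le> R\<^sup>2 / (real m + 2)"
      using s by (intro divide_left_mono) auto
    ultimately show ?thesis
      using descent[of s] s m(1) by simp
  qed
  define c where "c = R\<^sup>2 / (real m + 2) - 2 * R * \<delta> / (G * sqrt (real t + 2))"
  have "d (Suc s) \<le> d m + (real s + 1 - real m) * c" if "m \<le> s" "s \<le> t" for s
    using that
  proof (induction s rule: nat_induct_at_least)
    case base
    then show ?case using step[of m] m by (simp add: c_def)
  next
    case (Suc s)
    then have "d (Suc s) \<le> d m + (real s + 1 - real m) * c" and "d (Suc (Suc s)) \<le> d (Suc s) + c"
      using step[of "Suc s"] by (simp_all add: c_def)
    then show ?case by (simp add: algebra_simps)
  qed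
  \<comment> \<open>Telescoping over the whole window: one \<open>R\<^sup>2\<close> comes from the
    initial distance \<open>d m\<close>, and the squared steps will contribute at most another
    one.\<close>
  from this[OF m(2) order_refl]
  have "(real t + 1 - real m) * (2 * R * \<delta> / (G * sqrt (real t + 2))) \<le>
      R\<^sup>2 + (real t + 1 - real m) * (R\<^sup>2 / (real m + 2))"
    using nonneg diam[OF m(1)] unfolding c_def right_diff_distrib by linarith
  also have "(real t + 1 - real m) * (R\<^sup>2 / (real m + 2)) \<le> (real m + 2) * (R\<^sup>2 / (real m + 2))"
    using m by (intro mult_right_mono) auto
  also have "R\<^sup>2 + (real m + 2) * (R\<^sup>2 / (real m + 2)) = 2 * R\<^sup>2"
    by simp
  finally have 1: "(real t + 1 - real m) * (2 * R * \<delta> / (G * sqrt (real t + 2))) \<le> 2 * R\<^sup>2"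
    by simp
  have "(real t + 2) / 2 * (2 * R * \<delta> / (G * sqrt (real t + 2))) \<le>
      (real t + 1 - real m) * (2 * R * \<delta> / (G * sqrt (real t + 2)))"
    using m pos \<delta> by (intro mult_right_mono) auto
  with 1 have "(real t + 2) / 2 * (2 * R * \<delta> / (G * sqrt (real t + 2))) \<le> 2 * R\<^sup>2"
    by linarith
  moreover have eq: "(real t + 2) / 2 * (2 * R * \<delta> / (G * sqrt (real t + 2))) = R * \<delta> * sqrt (real t + 2) / G"
    using pos real_div_sqrt[of "real t + 2"] by (simp add: field_simps)
  ultimately have "R * \<delta> * sqrt (real t + 2) \<le> 2 * R\<^sup>2 * G"
    unfolding eq using pos by (simp add: pos_divide_le_eq)
  then have "R * (\<delta> * sqrt (real t + 2)) \<le> R * (2 * G * R)"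
    by (simp add: power2_eq_square mult_ac)
  then have "\<delta> * sqrt (real t + 2) \<le> 2 * G * R"
    using pos(1) by (simp only: mult_le_cancel_left_pos)
  then show ?thesis
    by (simp add: pos_le_divide_eq)
qed

section \<open>Constraints and disagreement terms\<close>

lemma vec_norm_smult: "vec_norm (s \<cdot>\<^sub>v v) = \<bar>s\<bar> * vec_norm v"
proof -
  have "(\<Sum>i<dim_vec v. (vec_index (s \<cdot>\<^sub>v v) i)\<^sup>2) = s\<^sup>2 * (\<Sum>i<dim_vec v. (vec_index v i)\<^sup>2)"
    by (simp add: power_mult_distrib sum_distrib_left)
  then show ?thesis
    by (simp add: vec_norm_def L2_set_def real_sqrt_mult)
qed

lemma has_gradient_vec_directional_deriv:
  assumes grad: "has_gradient_vec n f D z" and z: "z \<in> carrier_vec n" and v: "v \<in> carrier_vec n"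
  shows "((\<lambda>s. f (z + s \<cdot>\<^sub>v v)) has_real_derivative scalar_prod D v) (at 0)"
proof -
  have z0: "z + 0 \<cdot>\<^sub>v v = z"
    using z v by (intro eq_vecI) auto
  have "(\<lambda>s. (f (z + s \<cdot>\<^sub>v v) - f z) / s) \<midarrow>0\<rightarrow> scalar_prod D v"
  proof (rule LIM_I)
    fix r :: real
    assume r: "r > 0"
    \<comment> \<open>The added 1 keeps \<open>K\<close> positive when \<open>v\<close> is
      zero.\<close>
    define K where "K = vec_norm v + 1"
    have K: "K > 0" "vec_norm v < K" "0 \<le> vec_norm v"
      by (simp_all add: K_def vec_norm_def L2_set_nonneg add_nonneg_pos)
    have "r / K > 0" using r K by simp
    then obtain d where d: "d > 0" and
      D: "\<And>h. h \<in> carrier_vec n \<Longrightarrow> vec_norm h < d \<Longrightarrow>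
        \<bar>f (z + h) - f z - scalar_prod D h\<bar> \<le> r / K * vec_norm h"
      using grad unfolding has_gradient_vec_def by meson
    have "norm ((f (z + s \<cdot>\<^sub>v v) - f z) / s - scalar_prod D v) < r"
      if s: "s \<noteq> 0" "norm (s - 0) < d / K" for s
    proof -
      have "\<bar>s\<bar> * vec_norm v \<le> \<bar>s\<bar> * K" using K by (intro mult_left_mono) auto
      also have "\<dots> < d" using s K by (simp add: field_simps)
      finally have "\<bar>f (z + s \<cdot>\<^sub>v v) - f z - scalar_prod D (s \<cdot>\<^sub>v v)\<bar> \<le> r / K * (\<bar>s\<bar> * vec_norm v)"
        using D[of "s \<cdot>\<^sub>v v"] v by (simp add: vec_norm_smult)
      moreover have "scalar_prod D (s \<cdot>\<^sub>v v) = s * scalar_prod D v"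
        using grad v by (simp add: has_gradient_vec_def)
      ultimately have le: "\<bar>f (z + s \<cdot>\<^sub>v v) - f z - s * scalar_prod D v\<bar> \<le> (r / K * vec_norm v) * \<bar>s\<bar>"
        by (simp add: mult_ac)
      have "(f (z + s \<cdot>\<^sub>v v) - f z) / s - scalar_prod D v = (f (z + s \<cdot>\<^sub>v v) - f z - s * scalar_prod D v) / s"
        using s by (simp add: diff_divide_distrib)
      then have "norm ((f (z + s \<cdot>\<^sub>v v) - f z) / s - scalar_prod D v) \<le> r / K * vec_norm v"
        using le s by (simp add: pos_divide_le_eq)
      also have "\<dots> < r / K * K"
        using r K by (intro mult_strict_left_mono) auto
      also have "\<dots> = r" using K by simp
      finally show ?thesis .
    qed
    moreover have "d / K > 0" using d K by simp
    ultimately show "\<exists>e>0. \<forall>s. s \<noteq> 0 \<and> norm (s - 0) < e \<longrightarrow>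
        norm ((f (z + s \<cdot>\<^sub>v v) - f z) / s - scalar_prod D v) < r"
      by blast
  qed
  then show ?thesis
    by (simp add: has_field_derivative_iff z0)
qed

section \<open>Joint treatment of inequality and equality constraints\<close>

definition con_row :: "network \<Rightarrow> nat \<Rightarrow> nat \<Rightarrow> real Matrix.vec" where
  "con_row P i l = (if l < ineqs P then row (A_mat P i) l else row (E_mat P i) (l - ineqs P))"

definition con_val :: "network \<Rightarrow> nat \<Rightarrow> nat \<Rightarrow> real Matrix.vec \<Rightarrow> real" where
  "con_val P i l z = scalar_prod (con_row P i l) z +
     (if l < ineqs P then vec_index (b_vec P i) l else vec_index (g_vec P i) (l - ineqs P))"

text \<open>Both kinds of admissible residuals form a convex cone. Closure under sums and
  nonnegative combinations is what lets one argument serve inequalities and equations.\<close>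

definition con_ok :: "network \<Rightarrow> nat \<Rightarrow> real \<Rightarrow> bool" where
  "con_ok P l r \<longleftrightarrow> (if l < ineqs P then r \<le> 0 else r = 0)"

lemma con_ok_sum: "(\<And>i. i \<in> S \<Longrightarrow> con_ok P l (f i)) \<Longrightarrow> con_ok P l (sum f S)"
  by (auto simp: con_ok_def intro: sum_nonpos split: if_splits)

text \<open>Entry \<open>i\<close> of the weighted graph Laplacian, identity minus mixing matrix,
  applied to block \<open>l\<close> of \<open>y\<close>.\<close>

definition disagreement :: "network \<Rightarrow> nat \<Rightarrow> nat \<Rightarrow> aux \<Rightarrow> real" where
  "disagreement P l i y = y (l, i) - (\<Sum>j\<in>nbrs P l i. weight P l i j * y (l, j))"

lemma affected_subset: "affected P l \<subseteq> {..<agents P}"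
  by (auto simp: affected_def)

lemma finite_affected: "finite (affected P l)"
  using affected_subset finite_subset by blast

lemma finite_aux_idx: "finite (aux_idx P)"
proof (rule finite_subset)
  show "aux_idx P \<subseteq> {..<ineqs P + eqs P} \<times> {..<agents P}"
    using affected_subset by (auto simp: aux_idx_def)
qed simp

lemma nbrs_subset: "i \<in> affected P l \<Longrightarrow> nbrs P l i \<subseteq> affected P l"
  by (auto simp: nbrs_def induced_edges_def)

lemma local_idx_iff:
  "(l, j) \<in> local_idx P i \<longleftrightarrow> l < ineqs P + eqs P \<and> i \<in> affected P l \<and> j \<in> nbrs P l i"
proof -
  have "l \<in> ineqs_of P i \<union> (\<lambda>q. ineqs P + q) ` eqs_of P i \<longleftrightarrow> l < ineqs P + eqs P \<and> i \<in> affected P l"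
  proof (cases "l < ineqs P")
    case True
    then show ?thesis by (auto simp: ineqs_of_def)
  next
    case False
    then obtain q where "l = ineqs P + q" by (metis le_add_diff_inverse not_less)
    then show ?thesis by (auto simp: ineqs_of_def eqs_of_def)
  qed
  then show ?thesis by (auto simp: local_idx_def)
qed

lemma local_idx_subset: "local_idx P i \<subseteq> aux_idx P"
  using nbrs_subset by (fastforce simp: local_idx_iff aux_idx_def)

text \<open>Minimality of \<open>ystar\<close> is assumed only within \<open>aux_space P\<close>;
  this brings arbitrary families into that space.\<close>

lemma phi_restrict: "phi P (restrict y (aux_idx P)) = phi P y"
proof -
  have "local_aux P i (restrict y (aux_idx P)) = local_aux P i y" for i
    using local_idx_subset[of P i] by (auto simp: local_aux_def restrict_def fun_eq_iff)
  then show ?thesis by (simp add: phi_def)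
qed

lemma all_constraints_iff:
  fixes n m :: nat
  shows "(\<forall>l < n + m. Q l) \<longleftrightarrow> (\<forall>l < n. Q l) \<and> (\<forall>q < m. Q (n + q))"
  by (metis add_less_cancel_left le_add_diff_inverse not_less trans_less_add1)

lemma mem_local_feasible:
  "z \<in> local_feasible P i (local_aux P i y) \<longleftrightarrow> z \<in> carrier_vec (dimn P i) \<and>
    (\<forall>l < ineqs P + eqs P. i \<in> affected P l \<longrightarrow> con_ok P l (con_val P i l z + disagreement P l i y))"
proof -
  have loc: "local_aux P i y (l, j) = y (l, j)"
    if "l < ineqs P + eqs P" "i \<in> affected P l" "j \<in> nbrs P l i" for l j
    using that by (simp add: local_aux_def local_idx_iff)
  \<comment> \<open>An agent counts as its own neighbour, so the restriction to
    \<open>local_idx P i\<close> also keeps \<open>y (l, i)\<close>.\<close>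
  have val: "local_aux P i y (l, i) - (\<Sum>j\<in>nbrs P l i. weight P l i j * local_aux P i y (l, j))
      = disagreement P l i y" if "l < ineqs P + eqs P" "i \<in> affected P l" for l
    using that by (simp add: disagreement_def loc nbrs_def[of P l i, THEN eqset_imp_iff])
  have ineq: "scalar_prod (row (A_mat P i) m) z + local_aux P i y (m, i) -
      (\<Sum>j\<in>nbrs P m i. weight P m i j * local_aux P i y (m, j)) + vec_index (b_vec P i) m
      = con_val P i m z + disagreement P m i y" if "m < ineqs P" "i \<in> affected P m" for m
    using val[of m] that by (simp add: con_val_def con_row_def)
  have eq: "scalar_prod (row (E_mat P i) q) z + local_aux P i y (ineqs P + q, i) -
      (\<Sum>j\<in>nbrs P (ineqs P + q) i. weight P (ineqs P + q) i j * local_aux P i y (ineqs P + q, j)) +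
      vec_index (g_vec P i) q
      = con_val P i (ineqs P + q) z + disagreement P (ineqs P + q) i y"
    if "q < eqs P" "i \<in> affected P (ineqs P + q)" for q
    using val[of "ineqs P + q"] that by (simp add: con_val_def con_row_def)
  show ?thesis
    unfolding all_constraints_iff local_feasible_def Let_def con_ok_def ineqs_of_def eqs_of_def
    by (auto simp: ineq eq)
qed

text \<open>Unaffected agents have zero row and zero offset, so the global sums reduce to the
  vertices of the induced subgraph. The case split secures the dimensions under which a zero row
  gives product 0.\<close>

lemma feasible_iff:
  assumes "well_dimensioned P"
  shows "feasible P z \<longleftrightarrow> (\<forall>i < agents P. z i \<in> carrier_vec (dimn P i)) \<and>
    (\<forall>l < ineqs P + eqs P. con_ok P l (\<Sum>i\<in>affected P l. con_val P i l (z i)))"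
proof (cases "\<forall>i < agents P. z i \<in> carrier_vec (dimn P i)")
  case carrier: True
  have affected: "(\<Sum>i\<in>affected P l. con_val P i l (z i)) = (\<Sum>i<agents P. con_val P i l (z i))"
    if "l < ineqs P + eqs P" for l
  proof (rule sum.mono_neutral_left)
    show "\<forall>i\<in>{..<agents P} - affected P l. con_val P i l (z i) = 0"
      using carrier by (auto simp: affected_def con_val_def con_row_def split: if_splits)
  qed (use affected_subset in auto)
  have "(\<Sum>i<agents P. vec_index (A_mat P i *\<^sub>v z i + b_vec P i) m) = (\<Sum>i\<in>affected P m. con_val P i m (z i))"
    if "m < ineqs P" for m
    using that assms unfolding affected[OF trans_less_add1[OF that]]
    by (intro sum.cong) (auto simp: con_val_def con_row_def well_dimensioned_def)
  moreover have "(\<Sum>i<agents P. vec_index (E_mat P i *\<^sub>v z i + g_vec P i) q) =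
      (\<Sum>i\<in>affected P (ineqs P + q). con_val P i (ineqs P + q) (z i))"
    if "q < eqs P" for q
    using that assms unfolding affected[OF add_strict_left_mono[OF that]]
    by (intro sum.cong) (auto simp: con_val_def con_row_def well_dimensioned_def)
  ultimately show ?thesis
    using carrier unfolding all_constraints_iff feasible_def con_ok_def by auto
next
  case False
  then show ?thesis by (auto simp: feasible_def)
qed

lemma con_row_carrier:
  assumes "well_dimensioned P" "i < agents P" "l < ineqs P + eqs P"
  shows "con_row P i l \<in> carrier_vec (dimn P i)"
  using assms by (auto simp: con_row_def well_dimensioned_def intro!: carrier_vecI)

lemma con_val_affine:
  assumes "well_dimensioned P" "i < agents P" "l < ineqs P + eqs P"
    and "z \<in> carrier_vec (dimn P i)" "w \<in> carrier_vec (dimn P i)" "u + v = 1"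
  shows "con_val P i l (u \<cdot>\<^sub>v z + v \<cdot>\<^sub>v w) = u * con_val P i l z + v * con_val P i l w"
proof -
  have "scalar_prod (con_row P i l) (u \<cdot>\<^sub>v z + v \<cdot>\<^sub>v w) =
      u * scalar_prod (con_row P i l) z + v * scalar_prod (con_row P i l) w"
    using assms con_row_carrier[OF assms(1-3)]
    by (simp add: scalar_prod_add_distrib[where n = "dimn P i"])
  moreover have "b = u * b + v * b" for b
    using assms(6) by (metis distrib_right mult_1)
  ultimately show ?thesis
    by (simp add: con_val_def distrib_left)
qed

lemma con_val_shift:
  assumes "well_dimensioned P" "i < agents P" "l < ineqs P + eqs P"
    and "z \<in> carrier_vec (dimn P i)" "v \<in> carrier_vec (dimn P i)"
  shows "con_val P i l (z + s \<cdot>\<^sub>v v) = con_val P i l z + s * scalar_prod (con_row P i l) v"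
  using assms con_row_carrier[OF assms(1-3)]
  by (simp add: con_val_def scalar_prod_add_distrib[where n = "dimn P i"])

lemma disagreement_combination:
  "disagreement P l i (\<lambda>k. u * y k + v * z k) = u * disagreement P l i y + v * disagreement P l i z"
  by (simp add: disagreement_def sum.distrib sum_distrib_left algebra_simps)

lemma disagreement_shift:
  "disagreement P l i (\<lambda>k. y k + s * h k) = disagreement P l i y + s * disagreement P l i h"
  using disagreement_combination[of P l i 1 y s h] by simp

lemma mixing_weightsD:
  assumes "mixing_weights P l" "i \<in> affected P l"
  shows "j \<in> affected P l \<Longrightarrow> 0 \<le> weight P l i j"
    and "j \<in> affected P l \<Longrightarrow> weight P l i j = weight P l j i"
    and "j \<in> affected P l \<Longrightarrow> j \<in> nbrs P l i \<Longrightarrow> 0 < weight P l i j"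
    and "j \<in> affected P l \<Longrightarrow> j \<notin> nbrs P l i \<Longrightarrow> weight P l i j = 0"
    and "(\<Sum>j\<in>affected P l. weight P l i j) = 1"
  using assms unfolding mixing_weights_def by metis+

lemma disagreement_affected:
  assumes "mixing_weights P l" "i \<in> affected P l"
  shows "disagreement P l i y = y (l, i) - (\<Sum>j\<in>affected P l. weight P l i j * y (l, j))"
proof -
  have "(\<Sum>j\<in>nbrs P l i. weight P l i j * y (l, j)) = (\<Sum>j\<in>affected P l. weight P l i j * y (l, j))"
    using nbrs_subset[OF assms(2)] finite_affected mixing_weightsD(4)[OF assms]
    by (intro sum.mono_neutral_left) auto
  then show ?thesis by (simp add: disagreement_def)
qed

text \<open>By symmetry the columns of the mixing matrix also sum to 1, so mixing preserves the
  total of \<open>y\<close>.\<close>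

lemma sum_disagreement:
  assumes "mixing_weights P l"
  shows "(\<Sum>i\<in>affected P l. disagreement P l i y) = 0"
proof -
  let ?S = "affected P l"
  have "(\<Sum>i\<in>?S. \<Sum>j\<in>?S. weight P l i j * y (l, j)) = (\<Sum>j\<in>?S. (\<Sum>i\<in>?S. weight P l j i) * y (l, j))"
    using mixing_weightsD(2)[OF assms]
    by (subst sum.swap) (auto simp: sum_distrib_right intro!: sum.cong)
  also have "\<dots> = (\<Sum>j\<in>?S. y (l, j))"
    by (intro sum.cong) (auto simp: mixing_weightsD(5)[OF assms])
  finally show ?thesis
    using assms by (simp add: disagreement_affected sum_subtractf)
qed

section \<open>The local problems\<close>

locale agent_network =
  fixes P :: network and x :: "nat \<Rightarrow> aux \<Rightarrow> real Matrix.vec"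
  assumes dims: "well_dimensioned P"
    and connected: "\<And>l. l < ineqs P + eqs P \<Longrightarrow> induced_connected P l"
    and weights: "\<And>l. l < ineqs P + eqs P \<Longrightarrow> mixing_weights P l"
    and convex: "\<And>i. i < agents P \<Longrightarrow> convex_fun_on_vec (dimn P i) (cost P i)"
    and smooth: "\<And>i. i < agents P \<Longrightarrow> \<exists>\<alpha>>0. lipschitz_gradient_vec (dimn P i) (cost P i) \<alpha>"
    and rank: "\<And>i. i < agents P \<Longrightarrow> full_row_rank (constraint_rows P i)"
    and local_opt: "\<And>i yi. i < agents P \<Longrightarrow> yi \<in> extensional (local_idx P i) \<Longrightarrow>
                      local_solution P i yi (x i yi)"
begin

definition sol :: "aux \<Rightarrow> nat \<Rightarrow> real Matrix.vec" where
  "sol y i = x i (local_aux P i y)"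

lemma sol_arg_min:
  "i < agents P \<Longrightarrow> is_arg_min (cost P i) (\<lambda>z. z \<in> local_feasible P i (local_aux P i y)) (sol y i)"
  using local_opt[of i "local_aux P i y"] by (simp add: local_solution_def local_aux_def sol_def)

lemma sol_feasible: "i < agents P \<Longrightarrow> sol y i \<in> local_feasible P i (local_aux P i y)"
  using sol_arg_min by (simp add: is_arg_min_def)

lemma sol_carrier: "i < agents P \<Longrightarrow> sol y i \<in> carrier_vec (dimn P i)"
  using sol_feasible by (simp add: local_feasible_def)

lemma sol_le:
  "i < agents P \<Longrightarrow> z \<in> local_feasible P i (local_aux P i y) \<Longrightarrow> cost P i (sol y i) \<le> cost P i z"
  using sol_arg_min[of i y] by (auto simp: is_arg_min_linorder)

lemma phi_eq: "phi P y = total_cost P (sol y)"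
proof -
  have "local_value P i (local_aux P i y) = cost P i (sol y i)" if "i < agents P" for i
    unfolding local_value_def
    by (rule cInf_eq_minimum) (use that sol_feasible sol_le in auto)
  then show ?thesis by (simp add: phi_def total_cost_def)
qed

text \<open>For fixed \<open>y\<close> objective and constraints separate over the agents. All later
  upper bounds on \<open>phi\<close> come from here, by exhibiting a feasible point.\<close>

lemma phi_le: "reformulated_feasible P z y \<Longrightarrow> phi P y \<le> total_cost P z"
  unfolding phi_eq total_cost_def by (intro sum_mono sol_le) (auto simp: reformulated_feasible_def)

lemma sol_reformulated_optimal:
  "is_arg_min (total_cost P) (\<lambda>z. reformulated_feasible P z y) (sol y)"
  using phi_le phi_eq sol_feasible by (auto simp: is_arg_min_linorder reformulated_feasible_def)

text \<open>Adding up the local constraints of the affected agents cancels the disagreement terms.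
  No optimality of \<open>y\<close> enters, so this covers every iterate.\<close>

lemma sol_violation_free: "feasible P (sol y)"
  unfolding feasible_iff[OF dims]
proof (intro conjI allI impI)
  fix l assume l: "l < ineqs P + eqs P"
  have "con_ok P l (con_val P i l (sol y i) + disagreement P l i y)" if "i \<in> affected P l" for i
    using sol_feasible[of i y] that l affected_subset[of P l] by (auto simp: mem_local_feasible)
  then have "con_ok P l (\<Sum>i\<in>affected P l. con_val P i l (sol y i) + disagreement P l i y)"
    by (rule con_ok_sum)
  then show "con_ok P l (\<Sum>i\<in>affected P l. con_val P i l (sol y i))"
    by (simp add: sum.distrib sum_disagreement[OF weights[OF l]])
qed (simp add: sol_carrier)

text \<open>The total residual of each constraint is shared equally: the deviations of the agents'
  residuals from their mean sum to 0, so a Laplacian equation yields a \<open>y\<close> that raises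
  or lowers every residual to the mean, which is admissible.\<close>

lemma feasible_imp_reformulated_feasible:
  assumes "feasible P z"
  obtains y where "reformulated_feasible P z y"
proof -
  have "\<exists>f. \<forall>i\<in>affected P l. con_ok P l (con_val P i l (z i) +
      (f i - (\<Sum>j\<in>affected P l. weight P l i j * f j)))" if l: "l < ineqs P + eqs P" for l
  proof -
    let ?S = "affected P l"
    \<comment> \<open>For a constraint that affects nobody, division by 0 makes \<open>c\<close>
      equal to 0, which is admissible as well.\<close>
    define c where "c = (\<Sum>i\<in>?S. con_val P i l (z i)) / card ?S"
    have "con_ok P l (\<Sum>i\<in>?S. con_val P i l (z i))"
      using assms l by (simp add: feasible_iff[OF dims])
    then have c: "con_ok P l c"
      by (simp add: con_ok_def c_def divide_nonpos_nonneg split: if_splits)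
    have "(\<Sum>i\<in>?S. c - con_val P i l (z i)) = 0"
      using finite_affected[of P l] by (cases "?S = {}") (simp_all add: sum_subtractf c_def)
    then obtain f where f: "\<And>i. i \<in> ?S \<Longrightarrow>
        f i - (\<Sum>j\<in>?S. weight P l i j * f j) = c - con_val P i l (z i)"
    proof (rule laplacian_solvable[OF affected_subset[of P l], rotated 5])
      show "i \<in> ?S \<and> j \<in> ?S \<and> 0 < weight P l i j" if "(i, j) \<in> induced_edges P l" for i j
        using that mixing_weightsD(3)[OF weights[OF l]] by (auto simp: induced_edges_def nbrs_def)
      show "(i, j) \<in> (induced_edges P l)\<^sup>*" if "i \<in> ?S" "j \<in> ?S" for i j
        using that connected[OF l] by (simp add: induced_connected_def)
    qed (use mixing_weightsD[OF weights[OF l]] in auto)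
    then show ?thesis using c by (intro exI[of _ f]) simp
  qed
  then obtain f where f: "\<And>l i. l < ineqs P + eqs P \<Longrightarrow> i \<in> affected P l \<Longrightarrow>
      con_ok P l (con_val P i l (z i) + (f l i - (\<Sum>j\<in>affected P l. weight P l i j * f l j)))"
    by metis
  have "reformulated_feasible P z (\<lambda>(l, i). f l i)"
    unfolding reformulated_feasible_def mem_local_feasible
    using assms f by (auto simp: feasible_iff[OF dims] disagreement_affected[OF weights])
  then show ?thesis using that by blast
qed

text \<open>The constraints are jointly affine in the solution and \<open>y\<close>, so the
  combination of two optimal solutions is feasible for the combined \<open>y\<close>; convexity of
  the costs does the rest.\<close>

lemma phi_convex: "convex_on_funs (phi P)"
  unfolding convex_on_funs_def
proof (intro allI impI)
  fix y z :: aux and u v :: real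
  assume uv: "0 \<le> u" "0 \<le> v" "u + v = 1"
  let ?w = "\<lambda>i. u \<cdot>\<^sub>v sol y i + v \<cdot>\<^sub>v sol z i"
  have "reformulated_feasible P ?w (\<lambda>k. u * y k + v * z k)"
    unfolding reformulated_feasible_def mem_local_feasible
  proof (intro allI impI conjI)
    fix i l assume i: "i < agents P" and l: "l < ineqs P + eqs P" "i \<in> affected P l"
    have eq: "con_val P i l (?w i) + disagreement P l i (\<lambda>k. u * y k + v * z k) =
        u * (con_val P i l (sol y i) + disagreement P l i y) +
        v * (con_val P i l (sol z i) + disagreement P l i z)"
      by (simp add: con_val_affine[OF dims i l(1) sol_carrier[OF i] sol_carrier[OF i] uv(3)]
          disagreement_combination distrib_left)
    have "con_ok P l (con_val P i l (sol y i) + disagreement P l i y)"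
      "con_ok P l (con_val P i l (sol z i) + disagreement P l i z)"
      using sol_feasible[OF i] l by (auto simp: mem_local_feasible)
    then show "con_ok P l (con_val P i l (?w i) + disagreement P l i (\<lambda>k. u * y k + v * z k))"
      unfolding eq using uv
      by (auto simp: con_ok_def intro!: add_nonpos_nonpos mult_nonneg_nonpos split: if_splits)
  qed (use sol_carrier in simp)
  then have "phi P (\<lambda>k. u * y k + v * z k) \<le> total_cost P ?w"
    by (rule phi_le)
  also have "\<dots> \<le> (\<Sum>i<agents P. u * cost P i (sol y i) + v * cost P i (sol z i))"
    unfolding total_cost_def
    by (intro sum_mono) (use convex sol_carrier uv in \<open>auto simp: convex_fun_on_vec_def\<close>)
  finally show "phi P (\<lambda>k. u * y k + v * z k) \<le> u * phi P y + v * phi P z"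
    by (simp add: phi_eq total_cost_def sum.distrib sum_distrib_left)
qed

text \<open>Full row rank lets every agent compensate a change of \<open>y\<close> in a direction \<open>h\<close> by moving its
  optimal solution along a fixed direction, so \<open>phi\<close> lies below a differentiable function touching
  it at \<open>y\<close>; for a convex function this already forces differentiability.\<close>

lemma phi_upper_slope: "\<exists>D. upper_slope (phi P) y h D"
proof -
  have "\<exists>v. v \<in> carrier_vec (dimn P i) \<and> (\<forall>l < ineqs P + eqs P. i \<in> affected P l \<longrightarrow>
      scalar_prod (con_row P i l) v = - disagreement P l i h)" if i: "i < agents P" for i
  proof -
    obtain v where "v \<in> carrier_vec (dimn P i)"
      "\<And>m. m \<in> ineqs_of P i \<Longrightarrow> scalar_prod (row (A_mat P i) m) v = - disagreement P m i h"
      "\<And>q. q \<in> eqs_of P i \<Longrightarrow>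
        scalar_prod (row (E_mat P i) q) v = - disagreement P (ineqs P + q) i h"
      using constraint_direction[OF dims i rank[OF i], of "\<lambda>m. - disagreement P m i h"
          "\<lambda>q. - disagreement P (ineqs P + q) i h"] by blast
    then show ?thesis
      unfolding all_constraints_iff con_row_def ineqs_of_def eqs_of_def by (intro exI[of _ v]) auto
  qed
  then obtain v where v: "\<And>i. i < agents P \<Longrightarrow> v i \<in> carrier_vec (dimn P i)"
    "\<And>i l. i < agents P \<Longrightarrow> l < ineqs P + eqs P \<Longrightarrow> i \<in> affected P l \<Longrightarrow>
      scalar_prod (con_row P i l) (v i) = - disagreement P l i h"
    by metis
  have "\<exists>D. has_gradient_vec (dimn P i) (cost P i) D (sol y i)" if "i < agents P" for i
    using smooth[OF that] sol_carrier[OF that] by (auto simp: lipschitz_gradient_vec_def)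
  then obtain D where D: "\<And>i. i < agents P \<Longrightarrow> has_gradient_vec (dimn P i) (cost P i) (D i) (sol y i)"
    by metis
  \<comment> \<open>Along \<open>v\<close> the change of each constraint value cancels the change of
    the disagreement term, so residuals do not depend on \<open>s\<close>. The total cost on this
    line is therefore a majorant.\<close>
  define q where "q s = total_cost P (\<lambda>i. sol y i + s \<cdot>\<^sub>v v i)" for s
  have "(q has_real_derivative (\<Sum>i<agents P. scalar_prod (D i) (v i))) (at 0)"
    unfolding q_def total_cost_def
    by (intro DERIV_sum has_gradient_vec_directional_deriv) (use D sol_carrier v in auto)
  moreover have "sol y i + 0 \<cdot>\<^sub>v v i = sol y i" if "i < agents P" for i
    using sol_carrier[OF that, of y] v(1)[OF that] by (intro eq_vecI) auto
  then have "q 0 = phi P y"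
    by (simp add: q_def phi_eq total_cost_def)
  moreover have "phi P (\<lambda>k. y k + s * h k) \<le> q s" for s
    unfolding q_def
  proof (rule phi_le)
    show "reformulated_feasible P (\<lambda>i. sol y i + s \<cdot>\<^sub>v v i) (\<lambda>k. y k + s * h k)"
      unfolding reformulated_feasible_def mem_local_feasible
    proof (intro allI impI conjI)
      fix i l assume i: "i < agents P" and l: "l < ineqs P + eqs P" "i \<in> affected P l"
      have "con_ok P l (con_val P i l (sol y i) + disagreement P l i y)"
        using sol_feasible[OF i] l by (auto simp: mem_local_feasible)
      then show "con_ok P l (con_val P i l (sol y i + s \<cdot>\<^sub>v v i) + disagreement P l i (\<lambda>k. y k + s * h k))"
        by (simp add: con_val_shift[OF dims i l(1) sol_carrier[OF i] v(1)[OF i]] v(2)[OF i l]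
            disagreement_shift)
    qed (use sol_carrier v in simp)
  qed
  ultimately show ?thesis unfolding upper_slope_def by blast
qed

text \<open>The coordinate slopes are the partial derivatives in \<open>grad_phi\<close>; they add
  up to a slope in direction \<open>z - y\<close>, and convexity turns this slope into a lower
  bound.\<close>

lemma phi_gradient_ineq:
  assumes "y \<in> aux_space P" "z \<in> aux_space P"
  shows "phi P y + (\<Sum>k\<in>aux_idx P. grad_phi P y k * (z k - y k)) \<le> phi P z"
proof -
  let ?e = "\<lambda>j k :: nat \<times> nat. if k = j then 1 else 0 :: real"
  have grad: "upper_slope (phi P) y (?e j) (grad_phi P y j)" if "j \<in> aux_idx P" for j
  proof -
    obtain D where D: "upper_slope (phi P) y (?e j) D"
      using phi_upper_slope by blast
    from DERIV_imp_deriv[OF upper_slope_partial_deriv[OF phi_convex D]] that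
    have "grad_phi P y j = D" by (simp add: grad_phi_def)
    with D show ?thesis by simp
  qed
  \<comment> \<open>Outside \<open>aux_idx P\<close> both families are \<open>undefined\<close>, so
    they differ only on a finite index set.\<close>
  have z: "z = (\<lambda>k. y k + (if k \<in> aux_idx P then z k - y k else 0))"
    using assms by (auto simp: aux_space_def extensional_def fun_eq_iff)
  have "phi P y + (\<Sum>k\<in>aux_idx P. grad_phi P y k * (z k - y k)) \<le>
      phi P (\<lambda>k. y k + (if k \<in> aux_idx P then z k - y k else 0))"
    by (rule upper_slope_le[OF phi_convex upper_slope_sum[OF phi_convex finite_aux_idx grad]])
  also have "\<dots> = phi P z"
    by (simp only: z[symmetric])
  finally show ?thesis .
qed

end

section \<open>Projected gradient descent\<close>

lemma aux_norm_sq: "(aux_norm P z)\<^sup>2 = (\<Sum>k\<in>aux_idx P. (z k)\<^sup>2)"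
  by (simp add: aux_norm_def L2_set_def sum_nonneg)

lemma aux_box_subset: "aux_box P C \<subseteq> aux_space P"
  by (auto simp: aux_box_def aux_space_def PiE_def)

text \<open>A supremum of reals dominates its members once they are bounded above; here coordinates
  of box points differ by at most \<open>2 * C\<close>.\<close>

lemma box_dist_le_Theta:
  assumes y: "y \<in> aux_box P C" and z: "z \<in> aux_box P C"
  shows "(\<Sum>k\<in>aux_idx P. (y k - z k)\<^sup>2) \<le> 2 * Theta P C"
proof -
  let ?f = "\<lambda>(x, y). (aux_norm P (\<lambda>k. x k - y k))\<^sup>2 / 2"
  have "bdd_above (?f ` (aux_box P C \<times> aux_box P C))"
  proof (rule bdd_aboveI2)
    fix p assume p: "p \<in> aux_box P C \<times> aux_box P C"
    obtain u v where uv: "p = (u, v)" by fastforce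
    have "(u k - v k)\<^sup>2 \<le> (2 * C)\<^sup>2" if "k \<in> aux_idx P" for k
    proof (rule power2_le_iff_abs_le[THEN iffD2])
      have "u k \<in> {- C .. C}" "v k \<in> {- C .. C}"
        using p uv that by (auto simp: aux_box_def PiE_iff)
      then show "\<bar>u k - v k\<bar> \<le> 2 * C" "0 \<le> 2 * C" by auto
    qed
    then have "(\<Sum>k\<in>aux_idx P. (u k - v k)\<^sup>2) \<le> (\<Sum>k\<in>aux_idx P. (2 * C)\<^sup>2)"
      by (rule sum_mono)
    then show "?f p \<le> (\<Sum>k\<in>aux_idx P. (2 * C)\<^sup>2) / 2"
      by (simp add: uv aux_norm_sq del: sum_constant)
  qed
  from cSUP_upper[OF _ this, of "(y, z)"] y z
  show ?thesis by (simp add: Theta_def aux_norm_sq)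
qed

lemma closest_point_interval_dist:
  fixes C a z :: real
  assumes "z \<in> {- C .. C}"
  shows "(closest_point {- C .. C} a - z)\<^sup>2 \<le> (a - z)\<^sup>2"
proof -
  have "dist (closest_point {- C .. C} a) (closest_point {- C .. C} z) \<le> dist a z"
    using assms by (intro closest_point_lipschitz) auto
  then show ?thesis
    using closest_point_self[OF assms] by (simp add: dist_real_def abs_le_square_iff)
qed

lemma iterate_Suc_box:
  assumes "C > 0"
  shows "iterate P C \<gamma> y0 (Suc t) \<in> aux_box P C"
  using assms closest_point_in_set[of "{- C .. C}"] by (simp add: aux_box_def PiE_iff)

context agent_network
begin

text \<open>Coordinatewise projection does not increase the distance to a point \<open>z\<close> of
  the box. After expanding the square, the gradient inequality bounds the cross term and
  \<open>G\<close> the quadratic one.\<close>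

lemma descent:
  assumes y: "y \<in> aux_box P C" and z: "z \<in> aux_box P C" and "\<gamma> \<ge> 0"
    and bound: "aux_norm P (grad_phi P y) \<le> G"
  shows "(\<Sum>k\<in>aux_idx P. (closest_point {- C .. C} (y k - \<gamma> * grad_phi P y k) - z k)\<^sup>2) \<le>
    (\<Sum>k\<in>aux_idx P. (y k - z k)\<^sup>2) - 2 * \<gamma> * (phi P y - phi P z) + \<gamma>\<^sup>2 * G\<^sup>2"
proof -
  let ?g = "grad_phi P y"
  have "(\<Sum>k\<in>aux_idx P. (closest_point {- C .. C} (y k - \<gamma> * ?g k) - z k)\<^sup>2) \<le>
      (\<Sum>k\<in>aux_idx P. (y k - \<gamma> * ?g k - z k)\<^sup>2)"
    using z by (intro sum_mono closest_point_interval_dist) (auto simp: aux_box_def PiE_iff)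
  also have "\<dots> = (\<Sum>k\<in>aux_idx P. (y k - z k)\<^sup>2 + 2 * \<gamma> * (?g k * (z k - y k)) + \<gamma>\<^sup>2 * (?g k)\<^sup>2)"
    by (intro sum.cong) (auto simp: power2_eq_square algebra_simps)
  also have "\<dots> = (\<Sum>k\<in>aux_idx P. (y k - z k)\<^sup>2) +
      2 * \<gamma> * (\<Sum>k\<in>aux_idx P. ?g k * (z k - y k)) + \<gamma>\<^sup>2 * (aux_norm P ?g)\<^sup>2"
    by (simp add: sum.distrib sum_distrib_left aux_norm_sq)
  also have "\<dots> \<le> (\<Sum>k\<in>aux_idx P. (y k - z k)\<^sup>2) + 2 * \<gamma> * (phi P z - phi P y) + \<gamma>\<^sup>2 * G\<^sup>2"
  proof (intro add_mono mult_left_mono order_refl power_mono bound)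
    show "(\<Sum>k\<in>aux_idx P. ?g k * (z k - y k)) \<le> phi P z - phi P y"
      using phi_gradient_ineq[OF subsetD[OF aux_box_subset y] subsetD[OF aux_box_subset z]] by simp
  qed (use \<open>\<gamma> \<ge> 0\<close> in \<open>auto simp: aux_norm_def L2_set_nonneg\<close>)
  finally show ?thesis by (simp add: algebra_simps)
qed

lemma phi_min_le_optimum:
  assumes "is_arg_min (phi P) (\<lambda>y. y \<in> aux_space P) ystar" and "feasible P z"
  shows "phi P ystar \<le> total_cost P z"
proof -
  obtain y where y: "reformulated_feasible P z y"
    using feasible_imp_reformulated_feasible[OF assms(2)] .
  have "phi P ystar \<le> phi P (restrict y (aux_idx P))"
    using assms(1) by (auto simp: is_arg_min_linorder aux_space_def)
  also have "\<dots> \<le> total_cost P z"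
    using phi_le[OF y] by (simp add: phi_restrict)
  finally show ?thesis .
qed

end

section \<open>Feasibility and convergence rate of the iterates\<close>

theorem theorem2:
  fixes P :: network
    and C G :: real
    and \<gamma> :: "nat \<Rightarrow> real"
    and x :: "nat \<Rightarrow> aux \<Rightarrow> real Matrix.vec"
    and xstar :: "nat \<Rightarrow> real Matrix.vec"
    and y0 ystar :: aux
    and y :: "nat \<Rightarrow> aux"
    and t :: nat
  assumes dims: "well_dimensioned P"
    and graph: "undirected_graph P"
    and connected: "\<And>l. l < ineqs P + eqs P \<Longrightarrow> induced_connected P l"
    and weights: "\<And>l. l < ineqs P + eqs P \<Longrightarrow> mixing_weights P l"
    and convex: "\<And>i. i < agents P \<Longrightarrow> convex_fun_on_vec (dimn P i) (cost P i)"
    and smooth: "\<And>i. i < agents P \<Longrightarrow> \<exists>\<alpha>>0. lipschitz_gradient_vec (dimn P i) (cost P i) \<alpha>"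
    and rank: "\<And>i. i < agents P \<Longrightarrow> full_row_rank (constraint_rows P i)"
    and local_opt: "\<And>i yi. i < agents P \<Longrightarrow> yi \<in> extensional (local_idx P i) \<Longrightarrow>
                      local_solution P i yi (x i yi)"
    and C_pos: "C > 0"
    and minimizer: "is_arg_min (phi P) (\<lambda>y. y \<in> aux_space P) ystar" "ystar \<in> aux_box P C"
    and G_pos: "G > 0"
    and grad_bound: "\<And>y. y \<in> aux_box P C \<Longrightarrow> aux_norm P (grad_phi P y) \<le> G"
    and step: "\<And>t. \<gamma> t = sqrt (2 * Theta P C) / (G * sqrt (real t + 1))"
    and start: "y0 \<in> aux_space P"
    and iteration: "\<And>t. y t = iterate P C \<gamma> y0 t"
    and optimal: "is_arg_min (total_cost P) (feasible P) xstar"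
    and t_ge_2: "t \<ge> 2"
  shows "is_arg_min (total_cost P) (\<lambda>z. reformulated_feasible P z (y t))
           (\<lambda>i. x i (local_aux P i (y t))) \<and>
         feasible P (\<lambda>i. x i (local_aux P i (y t))) \<and>
         (MIN \<tau>\<in>{0..t}. \<Sum>i < agents P.
             cost P i (x i (local_aux P i (y \<tau>))) - cost P i (xstar i))
           \<le> 2 * (1 + ln 3) * G * sqrt (2 * Theta P C) / sqrt (real t + 2)"
proof -
  interpret agent_network P x
    using dims connected weights convex smooth rank local_opt by unfold_locales
  define R where "R = sqrt (2 * Theta P C)"
  \<comment> \<open>The gap is taken to the minimum of \<open>phi\<close>, where the descent
    estimate applies; the comparison with the optimal cost follows at the end.\<close>
  define gap where "gap s = phi P (y s) - phi P ystar" for s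
  define d where "d s = (\<Sum>k\<in>aux_idx P. (y s k - ystar k)\<^sup>2)" for s
  define \<delta> where "\<delta> = (MIN \<tau>\<in>{0..t}. gap \<tau>)"
  have sol: "(\<lambda>i. x i (local_aux P i z)) = sol z" for z
    by (simp add: sol_def fun_eq_iff)
  have "ystar \<in> aux_space P"
    using minimizer(1) by (simp add: is_arg_min_def)
  \<comment> \<open>The first projection puts the iterates into the box; \<open>y0\<close> itself
    may lie outside.\<close>
  have box: "y s \<in> aux_box P C" if "1 \<le> s" for s
    using iterate_Suc_box[OF C_pos, of P \<gamma> y0 "s - 1"] that by (simp add: iteration)
  have "y s \<in> aux_space P" for s
    using box[of s] start aux_box_subset[of P C] by (cases s) (auto simp: iteration)
  then have gap_nonneg: "0 \<le> gap s" for s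
    using minimizer(1) by (simp add: is_arg_min_linorder gap_def)
  have \<delta>: "0 \<le> \<delta>" "\<And>s. s \<le> t \<Longrightarrow> \<delta> \<le> gap s"
    using gap_nonneg by (auto simp: \<delta>_def)
  have dist: "d s \<le> 2 * Theta P C" if "1 \<le> s" for s
    unfolding d_def by (rule box_dist_le_Theta[OF box[OF that] minimizer(2)])
  have d_nonneg: "0 \<le> d s" for s
    by (simp add: d_def sum_nonneg)
  have Theta: "0 \<le> Theta P C"
    using dist[of 1] d_nonneg[of 1] by simp
  have "\<delta> \<le> 2 * G * R / sqrt (real t + 2)"
  \<comment> \<open>The rate estimate needs \<open>R > 0\<close>. If \<open>Theta\<close> vanishes,
    the box points \<open>y 1\<close> and \<open>ystar\<close> have distance 0 and coincide, so the
    gap at index 1 is 0.\<close>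
  proof (cases "Theta P C = 0")
    case True
    have "d 1 = 0"
      using True dist[of 1] d_nonneg[of 1] by simp
    then have "\<forall>k\<in>aux_idx P. y 1 k = ystar k"
      by (simp add: d_def sum_nonneg_eq_0_iff finite_aux_idx)
    then have "y 1 = ystar"
      using \<open>y 1 \<in> aux_space P\<close> \<open>ystar \<in> aux_space P\<close>
      by (auto simp: aux_space_def intro: extensionalityI)
    then have "\<delta> \<le> 0"
      using \<delta>(2)[of 1] t_ge_2 by (simp add: gap_def)
    then show ?thesis using True by (simp add: R_def)
  next
    case False
    then have R: "0 < R" "R\<^sup>2 = 2 * Theta P C"
      using Theta by (simp_all add: R_def)
    \<comment> \<open>The update of \<open>y s\<close> uses the step size of index
      \<open>Suc s\<close>, which turns \<open>t + 1\<close> under the root into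
      \<open>s + 2\<close>.\<close>
    have step_eq: "\<gamma> (Suc s) = R / (G * sqrt (real s + 2))" for s
      by (simp add: step R_def add.commute)
    show ?thesis
    proof (rule projected_gradient_rate)
      fix s :: nat assume s: "1 \<le> s"
      have "d (Suc s) = (\<Sum>k\<in>aux_idx P.
          (closest_point {- C .. C} (y s k - \<gamma> (Suc s) * grad_phi P (y s) k) - ystar k)\<^sup>2)"
        by (simp add: d_def iteration)
      also have "\<dots> \<le> d s - 2 * \<gamma> (Suc s) * gap s + (\<gamma> (Suc s))\<^sup>2 * G\<^sup>2"
        unfolding d_def gap_def
        using R G_pos by (intro descent box[OF s] minimizer(2) grad_bound) (simp add: step_eq)
      finally show "d (Suc s) \<le> d s - 2 * (R / (G * sqrt (real s + 2))) * gap s +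
          (R / (G * sqrt (real s + 2)))\<^sup>2 * G\<^sup>2"
        by (simp add: step_eq)
    qed (use R G_pos t_ge_2 \<delta> dist d_nonneg in auto)
  qed
  \<comment> \<open>The constant 2 is relaxed to the stated one, as \<open>ln 3\<close> is
    nonnegative.\<close>
  also have "\<dots> \<le> 2 * (1 + ln 3) * G * R / sqrt (real t + 2)"
    using G_pos Theta by (intro divide_right_mono mult_right_mono) (auto simp: R_def)
  finally have rate: "\<delta> \<le> 2 * (1 + ln 3) * G * R / sqrt (real t + 2)" .
  have "\<delta> \<in> gap ` {0..t}"
    unfolding \<delta>_def by (rule Min_in) auto
  then obtain \<tau> where \<tau>: "\<tau> \<le> t" "\<delta> = gap \<tau>"
    by auto
  have "feasible P xstar"
    using optimal by (simp add: is_arg_min_def)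
  \<comment> \<open>At the index that attains the smallest gap, the cost of the local solutions is
    \<open>phi\<close>, and the minimum of \<open>phi\<close> is at most the optimal cost of the
    original problem.\<close>
  have "(MIN \<tau>\<in>{0..t}. \<Sum>i < agents P.
      cost P i (x i (local_aux P i (y \<tau>))) - cost P i (xstar i)) \<le>
      (\<Sum>i < agents P. cost P i (sol (y \<tau>) i) - cost P i (xstar i))"
    using \<tau>(1) by (intro Min_le) (auto simp: sol_def)
  also have "\<dots> = phi P (y \<tau>) - total_cost P xstar"
    by (simp add: phi_eq total_cost_def sum_subtractf)
  also have "\<dots> \<le> \<delta>"
    using phi_min_le_optimum[OF minimizer(1) \<open>feasible P xstar\<close>] by (simp add: \<tau>(2) gap_def)
  finally show ?thesis
    unfolding sol using rate sol_reformulated_optimal sol_violation_free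
    by (auto simp: R_def)
qed

end
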